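(* Let $X_1, X_2, \dots, X_n$ be $n$ independent real random variables with $\mathbb{E}[X_i] = 0$ and $X_i \ge -1$ for each $i$, and let $X = \sum_{i=1}^n X_i$. Then $$\text{Prob}[X \le 1] \ge 0.1587.$$
   Context: $\text{Prob}$ denotes probability and $\mathbb{E}$ denotes expectation. The number $n$ of random variables is an arbitrary positive integer, and the random variables are not assumed to be identically distributed. *)

theory Defs
  imports "HOL-Probability.Probability"
begin

end

theory Submission
  imports Defs
begin

text \<open>
  A mean-zero law on \<open>[-1, \<infinity>)\<close> is a mixture of mean-zero laws with two atoms \<open>-a\<close> and \<open>b\<close>,
  where \<open>0 < a \<le> 1\<close> and \<open>0 < b\<close>; so it suffices to treat sums of such two-point variables.

  Let \<open>\<sigma>\<close> be the standard deviation of the sum. As long as some \<open>b\<close> exceeds \<open>4\<sigma>/3\<close>, condition on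
  that variable being \<open>-a\<close>. This costs a factor \<open>b / (a + b) \<ge> exp (- a / b)\<close>, and the threshold
  \<open>D\<close>, initially \<open>1\<close>, rises by \<open>a\<close>. One stops when \<open>D \<ge> 0.57 \<sigma>\<close> or when every \<open>b\<close> is at most
  \<open>4\<sigma>/3\<close>. In the first case Cantelli's inequality applies to the remaining sum. In the second case
  its third and fourth moments are controlled, and a quartic test function bounds the probability.
  The product of the factors is at least \<open>exp (- 3 * 0.57 / 4)\<close> in the first case and at least
  \<open>exp (- 3 D / (4 \<sigma>))\<close> in the second, which the two bounds can afford.
\<close>

section \<open>Sums of independent two-point variables\<close>

text \<open>
  A pair \<open>(a, b)\<close> stands for the mean-zero law with atoms \<open>-a\<close> and \<open>b\<close>, and \<open>tp_exp l h\<close> is the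
  expectation of \<open>h\<close> at the sum of independent variables with the laws listed in \<open>l\<close>.
\<close>

primrec tp_exp :: "(real \<times> real) list \<Rightarrow> (real \<Rightarrow> real) \<Rightarrow> real" where
  "tp_exp [] h = h 0"
| "tp_exp (p # l) h = (snd p * tp_exp l (\<lambda>x. h (x - fst p)) + fst p * tp_exp l (\<lambda>x. h (x + snd p)))
     / (fst p + snd p)"

definition tp_valid :: "(real \<times> real) list \<Rightarrow> bool" where
  "tp_valid l \<longleftrightarrow> (\<forall>(a, b) \<in> set l. 0 < a \<and> a \<le> 1 \<and> 0 < b)"

text \<open>Since \<open>a * b\<close> is the variance of the law \<open>(a, b)\<close>, the three
  abbreviations below are the second, third and fourth cumulants of the sum.\<close>

definition tp_sum :: "(real \<Rightarrow> real \<Rightarrow> real) \<Rightarrow> (real \<times> real) list \<Rightarrow> real" where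
  "tp_sum f l = (\<Sum>(a, b)\<leftarrow>l. a * b * f a b)"

abbreviation tp_var :: "(real \<times> real) list \<Rightarrow> real" where
  "tp_var \<equiv> tp_sum (\<lambda>a b. 1)"

abbreviation tp_skew :: "(real \<times> real) list \<Rightarrow> real" where
  "tp_skew \<equiv> tp_sum (\<lambda>a b. b - a)"

abbreviation tp_kurt :: "(real \<times> real) list \<Rightarrow> real" where
  "tp_kurt \<equiv> tp_sum (\<lambda>a b. b\<^sup>2 - 4 * a * b + a\<^sup>2)"

lemma tp_valid_Cons [simp]:
  "tp_valid ((a, b) # l) \<longleftrightarrow> 0 < a \<and> a \<le> 1 \<and> 0 < b \<and> tp_valid l"
  by (auto simp: tp_valid_def)

lemma tp_valid_append [simp]: "tp_valid (l @ l') \<longleftrightarrow> tp_valid l \<and> tp_valid l'"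
  by (auto simp: tp_valid_def)

lemma tp_valid_Nil [simp]: "tp_valid []"
  by (simp add: tp_valid_def)

lemma tp_sum_simps [simp]:
  "tp_sum f [] = 0"
  "tp_sum f ((a, b) # l) = a * b * f a b + tp_sum f l"
  "tp_sum f (l @ l') = tp_sum f l + tp_sum f l'"
  by (simp_all add: tp_sum_def)

lemma tp_sum_mono:
  assumes "tp_valid l" "\<And>a b. (a, b) \<in> set l \<Longrightarrow> f a b \<le> g a b"
  shows "tp_sum f l \<le> tp_sum g l"
  using assms
proof (induction l)
  case (Cons p l)
  obtain a b where p: "p = (a, b)" by (cases p)
  show ?case
    using Cons unfolding p by (auto intro!: add_mono mult_left_mono)
qed simp

lemma tp_sum_affine: "tp_sum (\<lambda>a b. u * f a b + v) l = u * tp_sum f l + v * tp_var l"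
  by (induction l) (auto simp: algebra_simps)

lemma tp_var_nonneg: "tp_valid l \<Longrightarrow> 0 \<le> tp_var l"
  using tp_sum_mono[of l "\<lambda>_ _. 0" "\<lambda>_ _. 1"] tp_sum_affine[of 0 "\<lambda>_ _. 0" 0 l] by simp

lemma tp_exp_mono:
  assumes "tp_valid l" "\<And>x. h x \<le> k x"
  shows "tp_exp l h \<le> tp_exp l k"
  using assms
proof (induction l arbitrary: h k)
  case (Cons p l)
  obtain a b where p: "p = (a, b)" by (cases p)
  show ?case
    using Cons unfolding p by (auto intro!: divide_right_mono add_mono mult_left_mono)
qed simp

lemma tp_exp_const: "tp_valid l \<Longrightarrow> tp_exp l (\<lambda>x. c) = c"
proof (induction l)
  case (Cons p l)
  obtain a b where p: "p = (a, b)" by (cases p)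
  show ?case
    using Cons unfolding p by (simp add: field_simps)
qed simp

text \<open>Cumulants add over independent summands, and a centred fourth moment is three times the
  squared variance plus the fourth cumulant. Coefficients stay arbitrary because shifting by an atom
  turns one quartic into another.\<close>

lemma tp_exp_quartic:
  assumes "tp_valid l"
  shows "tp_exp l (\<lambda>x. c0 + c1 * x + c2 * x ^ 2 + c3 * x ^ 3 + c4 * x ^ 4)
    = c0 + c2 * tp_var l + c3 * tp_skew l + c4 * (3 * (tp_var l)\<^sup>2 + tp_kurt l)"
  using assms
proof (induction l arbitrary: c0 c1 c2 c3 c4)
  case (Cons p l)
  obtain a b where p: "p = (a, b)" by (cases p)
  have ab: "a + b > 0" and l: "tp_valid l" using Cons.prems by (auto simp: p)
  have shift: "c0 + c1 * (x + y) + c2 * (x + y) ^ 2 + c3 * (x + y) ^ 3 + c4 * (x + y) ^ 4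
    = (c0 + c1 * y + c2 * y ^ 2 + c3 * y ^ 3 + c4 * y ^ 4)
      + (c1 + 2 * c2 * y + 3 * c3 * y ^ 2 + 4 * c4 * y ^ 3) * x
      + (c2 + 3 * c3 * y + 6 * c4 * y ^ 2) * x ^ 2 + (c3 + 4 * c4 * y) * x ^ 3 + c4 * x ^ 4"
    for x y :: real
    by algebra
  have eq: "tp_exp l (\<lambda>x. c0 + c1 * (x + y) + c2 * (x + y) ^ 2 + c3 * (x + y) ^ 3 + c4 * (x + y) ^ 4)
    = (c0 + c1 * y + c2 * y ^ 2 + c3 * y ^ 3 + c4 * y ^ 4)
      + (c2 + 3 * c3 * y + 6 * c4 * y ^ 2) * tp_var l + (c3 + 4 * c4 * y) * tp_skew l
      + c4 * (3 * (tp_var l)\<^sup>2 + tp_kurt l)" for y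
    unfolding shift by (rule Cons.IH[OF l])
  show ?case
    using ab
    unfolding p tp_exp.simps fst_conv snd_conv eq eq[of "- a", unfolded add_uminus_conv_diff]
      tp_sum_simps
    by (simp add: divide_eq_eq) algebra
qed simp

text \<open>Conditioning on the variable \<open>(a, b)\<close> being \<open>-a\<close>.\<close>

lemma tp_exp_remove:
  assumes "tp_valid (l @ (a, b) # l')" "\<And>x. 0 \<le> h x"
  shows "b / (a + b) * tp_exp (l @ l') (\<lambda>x. h (x - a)) \<le> tp_exp (l @ (a, b) # l') h"
  using assms
proof (induction l arbitrary: h)
  case Nil
  have "0 \<le> tp_exp l' (\<lambda>x. h (x + b))"
    using tp_exp_mono[of l' "\<lambda>x. 0" "\<lambda>x. h (x + b)"] Nil by (simp add: tp_exp_const)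
  with Nil show ?case by (simp add: add_divide_distrib)
next
  case (Cons p l)
  obtain c d where p: "p = (c, d)" by (cases p)
  have pos: "0 < c" "0 < d" and v: "tp_valid (l @ (a, b) # l')" using Cons.prems by (auto simp: p)
  define r where "r = b / (a + b)"
  note IH = Cons.IH[OF v, folded r_def]
  have 1: "r * tp_exp (l @ l') (\<lambda>x. h (x - a - c)) \<le> tp_exp (l @ (a, b) # l') (\<lambda>x. h (x - c))"
    using Cons.prems by (intro IH) auto
  have 2: "r * tp_exp (l @ l') (\<lambda>x. h (x - a + d)) \<le> tp_exp (l @ (a, b) # l') (\<lambda>x. h (x + d))"
    using Cons.prems by (intro IH) auto
  have "r * tp_exp (p # l @ l') (\<lambda>x. h (x - a))
    = (d * (r * tp_exp (l @ l') (\<lambda>x. h (x - a - c))) + c * (r * tp_exp (l @ l') (\<lambda>x. h (x - a + d))))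
      / (c + d)"
    by (simp add: p algebra_simps)
  also have "\<dots> \<le> (d * tp_exp (l @ (a, b) # l') (\<lambda>x. h (x - c))
      + c * tp_exp (l @ (a, b) # l') (\<lambda>x. h (x + d))) / (c + d)"
    using pos 1 2 by (intro divide_right_mono add_mono mult_left_mono) auto
  finally show ?case
    by (simp add: p r_def)
qed

section \<open>Tail bounds by test polynomials\<close>

text \<open>The parabola \<open>1 - ((x * D + V) / k)\<^sup>2\<close> lies below the indicator, as
  the square is at least 1 beyond \<open>D\<close>; its mean is the bound.\<close>

lemma cantelli_tp:
  assumes l: "tp_valid l" and D: "0 < D"
  shows "D\<^sup>2 / (D\<^sup>2 + tp_var l) \<le> tp_exp l (indicator {..D})"
proof -
  define V where "V = tp_var l"
  have V: "0 \<le> V" using tp_var_nonneg[OF l] by (simp add: V_def)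
  define k where "k = D\<^sup>2 + V"
  have k: "0 < k" using D V by (simp add: k_def add_pos_nonneg)
  have "tp_exp l (\<lambda>x. (1 - V\<^sup>2 / k\<^sup>2) + (- 2 * D * V / k\<^sup>2) * x + (- D\<^sup>2 / k\<^sup>2) * x ^ 2
      + 0 * x ^ 3 + 0 * x ^ 4) \<le> tp_exp l (indicator {..D})"
  proof (rule tp_exp_mono[OF l])
    fix x
    have "(1 - V\<^sup>2 / k\<^sup>2) + (- 2 * D * V / k\<^sup>2) * x + (- D\<^sup>2 / k\<^sup>2) * x ^ 2 + 0 * x ^ 3 + 0 * x ^ 4
      = 1 - ((x * D + V) / k)\<^sup>2"
      using k by (simp add: field_simps power2_eq_square)
    also have "\<dots> \<le> indicator {..D} x"
    proof (cases "x \<le> D")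
      case False
      then have "D * D \<le> x * D" using D by (intro mult_right_mono) auto
      then have "1 \<le> (x * D + V) / k" using k by (simp add: k_def power2_eq_square)
      then show ?thesis using False by (simp add: one_le_power)
    qed simp
    finally show "(1 - V\<^sup>2 / k\<^sup>2) + (- 2 * D * V / k\<^sup>2) * x + (- D\<^sup>2 / k\<^sup>2) * x ^ 2
      + 0 * x ^ 3 + 0 * x ^ 4 \<le> indicator {..D} x" .
  qed
  then have "1 - V\<^sup>2 / k\<^sup>2 - D\<^sup>2 / k\<^sup>2 * V \<le> tp_exp l (indicator {..D})"
    unfolding tp_exp_quartic[OF l] by (simp add: V_def)
  moreover have "1 - V\<^sup>2 / k\<^sup>2 - D\<^sup>2 / k\<^sup>2 * V = 1 - V * k / k\<^sup>2"
    by (simp add: k_def algebra_simps power2_eq_square add_divide_distrib)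
  moreover have "V * k / k\<^sup>2 = V / k" "1 - V / k = (k - V) / k" "k - V = D\<^sup>2"
    using k by (simp_all add: power2_eq_square diff_divide_distrib) (simp add: k_def power2_eq_square)
  ultimately show ?thesis by (simp add: k_def V_def)
qed

text \<open>
  The quartic below has a double zero at \<open>1 / m\<close>, a simple zero at \<open>1 / n\<close>, and the value \<open>1\<close> with
  vanishing derivative at \<open>0\<close>: it is the extremal polynomial for a law on three points.
\<close>

lemma quartic_test_le:
  fixes m n t :: real
  assumes m: "0 < m" "m \<le> n"
  defines "q \<equiv> 1 - (3 * m\<^sup>2 + (2 * m + n) * n) * t ^ 2 + 2 * m * (m\<^sup>2 + (2 * m + n) * n) * t ^ 3
    - m\<^sup>2 * (2 * m + n) * n * t ^ 4"
  shows "q \<le> 1" "1 / n \<le> t \<Longrightarrow> q \<le> 0"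
proof -
  define G where "G = (2 * m + n) * n"
  have "m\<^sup>2 \<le> n\<^sup>2" using m by (intro power_mono) auto
  moreover have "0 < m * n" "0 < n\<^sup>2" using m by simp_all
  moreover have "G = 2 * (m * n) + n\<^sup>2" by (simp add: G_def power2_eq_square algebra_simps)
  ultimately have G: "m\<^sup>2 \<le> G" "0 < G" by linarith+
  \<comment> \<open>Completing the square in \<open>t\<close> after scaling by
    \<open>G\<close>.\<close>
  have "G * (3 * m\<^sup>2 + G - 2 * m * (m\<^sup>2 + G) * t + m\<^sup>2 * G * t\<^sup>2)
    = (m * G * t - (m\<^sup>2 + G))\<^sup>2 + m\<^sup>2 * (G - m\<^sup>2)"
    by algebra
  also have "\<dots> \<ge> 0" using G by simp
  finally have "0 \<le> 3 * m\<^sup>2 + G - 2 * m * (m\<^sup>2 + G) * t + m\<^sup>2 * G * t\<^sup>2"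
    using G by (simp add: zero_le_mult_iff)
  then have "0 \<le> t\<^sup>2 * (3 * m\<^sup>2 + G - 2 * m * (m\<^sup>2 + G) * t + m\<^sup>2 * G * t\<^sup>2)" by simp
  also have "\<dots> = 1 - q" unfolding q_def G_def by algebra
  finally show "q \<le> 1" by simp
  assume t: "1 / n \<le> t"
  then have nt: "1 \<le> t * n" using m by (simp add: divide_le_eq)
  have "0 < 1 / n" using m by simp
  then have "0 \<le> t" using t by linarith
  then have "0 \<le> (1 - m * t)\<^sup>2 * ((t * n - 1) * (1 + (2 * m + n) * t))"
    using m nt by (intro mult_nonneg_nonneg) auto
  also have "\<dots> = - q" unfolding q_def by algebra
  finally show "q \<le> 0" by simp
qed

text \<open>
  The value of \<open>1 - (3 m\<^sup>2 + G) t\<^sup>2 + 2 m (m\<^sup>2 + G) t\<^sup>3 - m\<^sup>2 G t\<^sup>4\<close> in the mean, for \<open>t = Z + y\<close> and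
  a standardised \<open>Z\<close> with skewness \<open>s\<close> and excess kurtosis \<open>\<kappa>\<close>.
\<close>

definition quartic_mean :: "real \<Rightarrow> real \<Rightarrow> real \<Rightarrow> real \<Rightarrow> real \<Rightarrow> real" where
  "quartic_mean m n y s \<kappa> = 1 - (3 * m\<^sup>2 + (2 * m + n) * n) * (1 + y\<^sup>2)
     + 2 * m * (m\<^sup>2 + (2 * m + n) * n) * (s + 3 * y + y ^ 3)
     - m\<^sup>2 * (2 * m + n) * n * (3 + \<kappa> + 4 * y * s + 6 * y\<^sup>2 + y ^ 4)"

text \<open>
  The resulting bound is affine in the skewness of the standardised sum, which lies in
  \<open>[-d', \<beta>]\<close>, so that it only has to be checked at the end points.
\<close>

lemma fourth_moment_tp:
  fixes l :: "(real \<times> real) list" and \<sigma> D d d' \<beta> m n y p :: real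
  assumes l: "tp_valid l" and \<sigma>: "\<sigma> > 0" "\<sigma>\<^sup>2 = tp_var l"
    and D: "1 \<le> D" "d * \<sigma> \<le> D" "D \<le> d' * \<sigma>"
    and b: "\<And>a b. (a, b) \<in> set l \<Longrightarrow> b \<le> \<beta> * \<sigma>"
    and \<beta>: "0 \<le> \<beta>"
    and m: "0 < m" "m \<le> n" "1 / n \<le> d + y"
    and p: "p \<le> quartic_mean m n y (- d') (d'\<^sup>2)" "p \<le> quartic_mean m n y \<beta> (\<beta>\<^sup>2)"
  shows "p \<le> tp_exp l (indicator {..D})"
proof -
  define G where "G = (2 * m + n) * n"
  \<comment> \<open>The kurtosis argument is the chord of the square function over
    \<open>[- d', \<beta>]\<close>, evaluated at \<open>s\<close>; so \<open>v\<close> is affine and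
    takes the two values bounded in \<open>p\<close> at the ends.\<close>
  define v where "v s = quartic_mean m n y s ((\<beta> - d') * s + d' * \<beta>)" for s
  define s where "s = tp_skew l / \<sigma> ^ 3"
  define \<kappa> where "\<kappa> = tp_kurt l / \<sigma> ^ 4"
  define q where "q t = 1 - (3 * m\<^sup>2 + (2 * m + n) * n) * t ^ 2
    + 2 * m * (m\<^sup>2 + (2 * m + n) * n) * t ^ 3 - m\<^sup>2 * (2 * m + n) * n * t ^ 4" for t
  have d': "0 < d'" using D \<sigma> by (smt (verit) mult_nonpos_nonneg)
  \<comment> \<open>The lower bound on \<open>b' - a\<close> comes from
    \<open>a \<le> 1 \<le> D \<le> d' * \<sigma>\<close>.\<close>
  have ab: "0 < a" "a \<le> 1" "0 < b'" "b' \<le> \<beta> * \<sigma>" "- (d' * \<sigma>) \<le> b' - a" "b' - a \<le> \<beta> * \<sigma>"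
    if "(a, b') \<in> set l" for a b'
    using that l b[OF that] D by (auto simp: tp_valid_def)
  have "tp_skew l \<le> tp_sum (\<lambda>a b. 0 * 1 + \<beta> * \<sigma>) l"
    using ab by (intro tp_sum_mono[OF l]) auto
  then have "tp_skew l \<le> \<beta> * \<sigma> ^ 3"
    unfolding tp_sum_affine by (simp flip: \<sigma>(2) add: power2_eq_square power3_eq_cube)
  then have s1: "s \<le> \<beta>" using \<sigma> by (simp add: s_def divide_le_eq)
  have "tp_sum (\<lambda>a b. 0 * 1 + (- (d' * \<sigma>))) l \<le> tp_skew l"
    using ab by (intro tp_sum_mono[OF l]) auto
  then have "- d' * \<sigma> ^ 3 \<le> tp_skew l"
    unfolding tp_sum_affine by (simp flip: \<sigma>(2) add: power2_eq_square power3_eq_cube)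
  then have s2: "- d' \<le> s" using \<sigma> by (simp add: s_def le_divide_eq)
  have "tp_kurt l \<le> tp_sum (\<lambda>a b. (\<beta> - d') * \<sigma> * (b - a) + d' * \<beta> * \<sigma>\<^sup>2) l"
  proof (rule tp_sum_mono[OF l])
    fix a b' assume mem: "(a, b') \<in> set l"
    \<comment> \<open>The square of \<open>b' - a\<close> lies below its chord over
      \<open>[- d' * \<sigma>, \<beta> * \<sigma>]\<close>, and the kurtosis term is that square
      less \<open>2 * a * b'\<close>.\<close>
    have "0 \<le> d' * \<sigma> + (b' - a)" "0 \<le> \<beta> * \<sigma> - (b' - a)" "0 \<le> 2 * a * b'"
      using ab[OF mem] by simp_all
    then have "0 \<le> (d' * \<sigma> + (b' - a)) * (\<beta> * \<sigma> - (b' - a)) + 2 * a * b'"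
      by (rule add_nonneg_nonneg[OF mult_nonneg_nonneg])
    also have "\<dots> = (\<beta> - d') * \<sigma> * (b' - a) + d' * \<beta> * \<sigma>\<^sup>2 - (b'\<^sup>2 - 4 * a * b' + a\<^sup>2)"
      by algebra
    finally show "b'\<^sup>2 - 4 * a * b' + a\<^sup>2 \<le> (\<beta> - d') * \<sigma> * (b' - a) + d' * \<beta> * \<sigma>\<^sup>2"
      by simp
  qed
  also have "\<dots> = (\<beta> - d') * \<sigma> * (s * \<sigma> ^ 3) + d' * \<beta> * \<sigma>\<^sup>2 * \<sigma>\<^sup>2"
    unfolding tp_sum_affine using \<sigma> by (simp flip: \<sigma>(2) add: s_def)
  also have "\<dots> = ((\<beta> - d') * s + d' * \<beta>) * \<sigma> ^ 4" by algebra
  finally have \<kappa>: "\<kappa> \<le> (\<beta> - d') * s + d' * \<beta>" using \<sigma> by (simp add: \<kappa>_def divide_le_eq)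
  have G: "0 < G" using m by (simp add: G_def)
  define c0 where "c0 = 1 - (3 * m\<^sup>2 + G) * y\<^sup>2 + 2 * m * (m\<^sup>2 + G) * y ^ 3 - m\<^sup>2 * G * y ^ 4"
  define c1 where "c1 = - 2 * (3 * m\<^sup>2 + G) * y + 6 * m * (m\<^sup>2 + G) * y\<^sup>2 - 4 * m\<^sup>2 * G * y ^ 3"
  define c2 where "c2 = - (3 * m\<^sup>2 + G) + 6 * m * (m\<^sup>2 + G) * y - 6 * m\<^sup>2 * G * y\<^sup>2"
  define c3 where "c3 = 2 * m * (m\<^sup>2 + G) - 4 * m\<^sup>2 * G * y"
  define c4 where "c4 = - m\<^sup>2 * G"
  have "tp_exp l (\<lambda>x. c0 + c1 / \<sigma> * x + c2 / \<sigma>\<^sup>2 * x ^ 2 + c3 / \<sigma> ^ 3 * x ^ 3 + c4 / \<sigma> ^ 4 * x ^ 4)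
    \<le> tp_exp l (indicator {..D})"
  proof (rule tp_exp_mono[OF l])
    fix x
    have "c0 + c1 / \<sigma> * x + c2 / \<sigma>\<^sup>2 * x ^ 2 + c3 / \<sigma> ^ 3 * x ^ 3 + c4 / \<sigma> ^ 4 * x ^ 4
      = c0 + c1 * (x / \<sigma>) + c2 * (x / \<sigma>) ^ 2 + c3 * (x / \<sigma>) ^ 3 + c4 * (x / \<sigma>) ^ 4"
      by (simp add: power_divide)
    also have "\<dots> = q (x / \<sigma> + y)"
      unfolding c0_def c1_def c2_def c3_def c4_def q_def G_def by algebra
    also have "\<dots> \<le> indicator {..D} x"
    proof (cases "x \<le> D")
      case True
      then show ?thesis using quartic_test_le(1)[OF m(1,2)] by (simp add: q_def)
    next
      case False
      then have "d \<le> x / \<sigma>" using D \<sigma> by (simp add: le_divide_eq)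
      then have "1 / n \<le> x / \<sigma> + y" using m by simp
      then show ?thesis using False quartic_test_le(2)[OF m(1,2)] by (simp add: q_def)
    qed
    finally show "c0 + c1 / \<sigma> * x + c2 / \<sigma>\<^sup>2 * x ^ 2 + c3 / \<sigma> ^ 3 * x ^ 3 + c4 / \<sigma> ^ 4 * x ^ 4
      \<le> indicator {..D} x" .
  qed
  moreover have "tp_exp l (\<lambda>x. c0 + c1 / \<sigma> * x + c2 / \<sigma>\<^sup>2 * x ^ 2 + c3 / \<sigma> ^ 3 * x ^ 3
      + c4 / \<sigma> ^ 4 * x ^ 4) = c0 + c2 + c3 * s + c4 * (3 + \<kappa>)"
    unfolding tp_exp_quartic[OF l] \<sigma>(2)[symmetric] s_def \<kappa>_def using \<sigma>(1)
    by (simp add: field_simps)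
  moreover have "v s \<le> c0 + c2 + c3 * s + c4 * (3 + \<kappa>)"
  proof -
    have "c4 * (3 + ((\<beta> - d') * s + d' * \<beta>)) \<le> c4 * (3 + \<kappa>)"
      using \<kappa> G by (intro mult_left_mono_neg) (auto simp: c4_def)
    moreover have "v s = c0 + c2 + c3 * s + c4 * (3 + ((\<beta> - d') * s + d' * \<beta>))"
      unfolding v_def quartic_mean_def G_def c0_def c2_def c3_def c4_def by algebra
    ultimately show ?thesis by simp
  qed
  moreover have "p \<le> v s"
  proof -
    have pos: "0 < \<beta> + d'" using \<beta> d' by simp
    have "v (- d') = quartic_mean m n y (- d') (d'\<^sup>2)" "v \<beta> = quartic_mean m n y \<beta> (\<beta>\<^sup>2)"
      by (simp_all add: v_def power2_eq_square algebra_simps)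
    then have "(\<beta> - s) * p + (s + d') * p \<le> (\<beta> - s) * v (- d') + (s + d') * v \<beta>"
      using s1 s2 p by (intro add_mono mult_left_mono) auto
    also have "\<dots> = (\<beta> + d') * v s"
      unfolding v_def quartic_mean_def by algebra
    finally have "(\<beta> + d') * p \<le> (\<beta> + d') * v s" by (simp add: algebra_simps)
    then show ?thesis using pos by simp
  qed
  ultimately show ?thesis by simp
qed

section \<open>The bound for two-point variables\<close>

text \<open>Replaces the exponential by a rational power that can be evaluated. The unit
  \<open>9 / 400\<close> is 3/4 of 3/100; it is cut into 16 parts because
  \<open>1 + x + x\<^sup>2\<close> is too crude a bound at \<open>9 / 400\<close> itself.\<close>

lemma exp_power_le:
  assumes "x \<le> real k * 3 / 100"
  shows "exp (3 / 4 * x) \<le> 1.02279 ^ k"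
proof -
  have "exp (9 / 6400 :: real) \<le> 1.001409"
    using exp_bound[of "9 / 6400"] by (simp add: power2_eq_square)
  then have "exp (9 / 6400 :: real) ^ 16 \<le> 1.001409 ^ 16"
    by (intro power_mono) auto
  also have "\<dots> \<le> (1.02279 :: real)" by (simp add: power_divide)
  also have "exp (9 / 6400 :: real) ^ 16 = exp (9 / 400)"
    by (simp flip: exp_of_nat_mult)
  finally have "exp (9 / 400 :: real) ^ k \<le> 1.02279 ^ k"
    by (intro power_mono) auto
  moreover have "exp (3 / 4 * x) \<le> exp (real k * (9 / 400))"
    using assms by simp
  ultimately show ?thesis
    unfolding exp_of_nat_mult by linarith
qed

text \<open>
  On the scale of the standardised sum, \<open>-y\<close> is the point where the quartic touches \<open>1\<close> and \<open>z\<close> its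
  double zero; their values in the eight cases were found by numerical optimisation.
\<close>

lemma small_atoms_bound:
  assumes l: "tp_valid l" and \<sigma>: "\<sigma> > 0" "\<sigma>\<^sup>2 = tp_var l"
    and D: "1 \<le> D" "D \<le> 57 / 100 * \<sigma>"
    and b: "\<And>a b. (a, b) \<in> set l \<Longrightarrow> b \<le> 4 / 3 * \<sigma>"
  shows "0.1587 * exp (3 / 4 * (D / \<sigma>)) \<le> tp_exp l (indicator {..D})"
proof -
  \<comment> \<open>On \<open>[d, d']\<close> the exponential is bounded at the right end and the
    simple zero of the quartic sits at the left end, which leaves two rational inequalities per
    interval.\<close>
  have step: ?thesis
    if "d \<le> D / \<sigma>" "D / \<sigma> \<le> d'" and r: "exp (3 / 4 * d') \<le> r"
      and yz: "0 < d + y" "d \<le> z"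
      and "0.1587 * r \<le> quartic_mean (1 / (z + y)) (1 / (d + y)) y (- d') (d'\<^sup>2)"
      and "0.1587 * r \<le> quartic_mean (1 / (z + y)) (1 / (d + y)) y (4 / 3) ((4 / 3)\<^sup>2)"
    for d d' r y z
  proof -
    have m: "0 < 1 / (z + y)" "1 / (z + y) \<le> 1 / (d + y)" "1 / (1 / (d + y)) \<le> d + y"
      using yz by (auto intro: divide_left_mono)
    have d: "d * \<sigma> \<le> D" "D \<le> d' * \<sigma>"
      using that(1,2) \<sigma> by (simp_all add: field_simps)
    have "exp (3 / 4 * (D / \<sigma>)) \<le> exp (3 / 4 * d')" using that(2) by simp
    also note r
    finally have "0.1587 * exp (3 / 4 * (D / \<sigma>)) \<le> 0.1587 * r"
      by (rule mult_left_mono) simp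
    also have "\<dots> \<le> tp_exp l (indicator {..D})"
      by (rule fourth_moment_tp[OF l \<sigma> D(1) d b _ m that(6,7)]) auto
    finally show ?thesis .
  qed
  have range: "0 \<le> D / \<sigma>" "D / \<sigma> \<le> 57 / 100"
    using D \<sigma> by (simp_all add: divide_le_eq)
  consider "D / \<sigma> \<le> 2 / 100" | "2 / 100 \<le> D / \<sigma>" "D / \<sigma> \<le> 6 / 100"
    | "6 / 100 \<le> D / \<sigma>" "D / \<sigma> \<le> 12 / 100" | "12 / 100 \<le> D / \<sigma>" "D / \<sigma> \<le> 21 / 100"
    | "21 / 100 \<le> D / \<sigma>" "D / \<sigma> \<le> 30 / 100" | "30 / 100 \<le> D / \<sigma>" "D / \<sigma> \<le> 39 / 100"
    | "39 / 100 \<le> D / \<sigma>" "D / \<sigma> \<le> 48 / 100" | "48 / 100 \<le> D / \<sigma>"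
    by linarith
  then show ?thesis
  proof cases
    case 1
    then show ?thesis
      by (intro step[of "0" "2 / 100" "1.015225" "17 / 10" "39 / 20"])
        (use range exp_bound[of "3 / 200"] in \<open>simp_all add: quartic_mean_def power_divide\<close>)
  next
    case 2
    then show ?thesis
      by (intro step[of "2 / 100" "6 / 100" "1.02279 ^ 2" "67 / 40" "19 / 10"])
        (use exp_power_le[of "6 / 100" 2] in \<open>simp_all add: quartic_mean_def power_divide\<close>)
  next
    case 3
    then show ?thesis
      by (intro step[of "6 / 100" "12 / 100" "1.02279 ^ 4" "17 / 10" "19 / 10"])
        (use exp_power_le[of "12 / 100" 4] in \<open>simp_all add: quartic_mean_def power_divide\<close>)
  next
    case 4
    then show ?thesis
      by (intro step[of "12 / 100" "21 / 100" "1.02279 ^ 7" "17 / 10" "9 / 5"])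
        (use exp_power_le[of "21 / 100" 7] in \<open>simp_all add: quartic_mean_def power_divide\<close>)
  next
    case 5
    then show ?thesis
      by (intro step[of "21 / 100" "30 / 100" "1.02279 ^ 10" "9 / 5" "9 / 5"])
        (use exp_power_le[of "30 / 100" 10] in \<open>simp_all add: quartic_mean_def power_divide\<close>)
  next
    case 6
    then show ?thesis
      by (intro step[of "30 / 100" "39 / 100" "1.02279 ^ 13" "9 / 5" "2"])
        (use exp_power_le[of "39 / 100" 13] in \<open>simp_all add: quartic_mean_def power_divide\<close>)
  next
    case 7
    then show ?thesis
      by (intro step[of "39 / 100" "48 / 100" "1.02279 ^ 16" "17 / 10" "12 / 5"])
        (use exp_power_le[of "48 / 100" 16] in \<open>simp_all add: quartic_mean_def power_divide\<close>)
  next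
    case 8
    then show ?thesis
      by (intro step[of "48 / 100" "57 / 100" "1.02279 ^ 19" "8 / 5" "3"])
        (use range exp_power_le[of "57 / 100" 19] in \<open>simp_all add: quartic_mean_def power_divide\<close>)
  qed
qed

text \<open>
  \<open>A\<close> is the rise of the threshold so far, and \<open>s\<close> the standard deviation at the previous step.
\<close>

lemma tp_bound_aux:
  assumes "tp_valid l" "0 \<le> A" "A \<le> 57 / 100 * s" "0 < s" "tp_var l \<le> s\<^sup>2"
  shows "0.1587 * exp (3 / 4 * (A / s)) \<le> tp_exp l (indicator {..1 + A})"
  using assms
\<comment> \<open>Induction on the length, as the variable to be removed may stand anywhere in the
  list.\<close>
proof (induction "length l" arbitrary: l A s)
  case (0 l A s)
  have "exp (3 / 4 * (A / s)) \<le> 1.02279 ^ 19"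
    using 0 by (intro exp_power_le) (simp add: divide_le_eq)
  then show ?case using 0 by (simp add: power_divide)
next
  case (Suc N l A s)
  note l = \<open>tp_valid l\<close>
  define \<sigma> where "\<sigma> = sqrt (tp_var l)"
  have \<sigma>: "0 \<le> \<sigma>" "\<sigma>\<^sup>2 = tp_var l" using tp_var_nonneg[OF l] by (auto simp: \<sigma>_def)
  have "\<sigma> \<le> s" using Suc.prems \<sigma> by (intro power2_le_imp_le[of \<sigma> s]) auto
  show ?case
  proof (cases "57 / 100 * \<sigma> \<le> 1 + A")
    case True
    have "exp (3 / 4 * (A / s)) \<le> 1.02279 ^ 19"
      using Suc.prems by (intro exp_power_le) (simp add: divide_le_eq)
    \<comment> \<open>\<open>3249 / 13249\<close> is the Cantelli bound at a threshold of exactly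
      0.57 standard deviations.\<close>
    then have "0.1587 * exp (3 / 4 * (A / s)) \<le> (3249 / 13249 :: real)" by (simp add: power_divide)
    also have "\<dots> \<le> (1 + A)\<^sup>2 / ((1 + A)\<^sup>2 + tp_var l)"
    proof -
      have "(57 / 100 * \<sigma>)\<^sup>2 \<le> (1 + A)\<^sup>2" using True \<sigma> by (intro power_mono) auto
      moreover have "0 < (1 + A)\<^sup>2" using Suc.prems by simp
      ultimately show ?thesis
        using tp_var_nonneg[OF l] \<sigma>(2)
        by (simp add: divide_simps power_mult_distrib add_pos_nonneg)
    qed
    also have "\<dots> \<le> tp_exp l (indicator {..1 + A})"
      using Suc.prems by (intro cantelli_tp[OF l]) auto
    finally show ?thesis .
  next
    case False
    then have pos: "0 < \<sigma>" using Suc.prems \<sigma> by (cases "\<sigma> = 0") auto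
    have A: "A / s \<le> A / \<sigma>" using Suc.prems pos \<open>\<sigma> \<le> s\<close> by (intro divide_left_mono) auto
    show ?thesis
    proof (cases "\<forall>(a, b) \<in> set l. b \<le> 4 / 3 * \<sigma>")
      case True
      have "A / \<sigma> \<le> (1 + A) / \<sigma>" using pos by (intro divide_right_mono) auto
      then have "3 / 4 * (A / s) \<le> 3 / 4 * ((1 + A) / \<sigma>)" using A by linarith
      then have "0.1587 * exp (3 / 4 * (A / s)) \<le> 0.1587 * exp (3 / 4 * ((1 + A) / \<sigma>))"
        by (intro mult_left_mono) auto
      also have "\<dots> \<le> tp_exp l (indicator {..1 + A})"
        using True False Suc.prems by (intro small_atoms_bound[OF l pos \<sigma>(2)]) auto
      finally show ?thesis .
    next
      case large: False
      then obtain a b where ab: "(a, b) \<in> set l" "4 / 3 * \<sigma> < b" by force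
      then obtain l1 l2 where l12: "l = l1 @ (a, b) # l2" by (meson split_list)
      have a: "0 < a" "a \<le> 1" "0 < b" using l by (auto simp: l12)
      \<comment> \<open>From \<open>1 + A < 57 / 100 * \<sigma>\<close> and
        \<open>a \<le> 1\<close>, the new rise \<open>A + a\<close> is still admissible with
        \<open>\<sigma>\<close> in the role of \<open>s\<close>.\<close>
      have IH: "0.1587 * exp (3 / 4 * ((A + a) / \<sigma>)) \<le> tp_exp (l1 @ l2) (indicator {..1 + (A + a)})"
        using Suc.prems Suc.hyps(2) False pos a \<sigma>(2) by (intro Suc.hyps(1)) (auto simp: l12)
      have "a / b \<le> 3 / 4 * (a / \<sigma>)" using a ab pos by (simp add: field_simps)
      then have "exp (- (3 / 4 * (a / \<sigma>))) \<le> inverse (exp (a / b))" by (simp add: exp_minus)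
      also have "\<dots> \<le> inverse (1 + a / b)"
        using a exp_ge_add_one_self[of "a / b"] by (intro le_imp_inverse_le) (auto simp: add_pos_pos)
      also have "\<dots> = b / (a + b)" using a by (simp add: field_simps)
      finally have factor: "exp (- (3 / 4 * (a / \<sigma>))) \<le> b / (a + b)" .
      have "0.1587 * exp (3 / 4 * (A / s)) \<le> 0.1587 * exp (3 / 4 * (A / \<sigma>))"
        using A by simp
      \<comment> \<open>The growth of the exponent from \<open>A\<close> to \<open>A + a\<close>
        pays exactly for the conditioning factor.\<close>
      also have "\<dots> = exp (- (3 / 4 * (a / \<sigma>))) * (0.1587 * exp (3 / 4 * ((A + a) / \<sigma>)))"
        by (simp add: add_divide_distrib distrib_left exp_add exp_minus)
      also have "\<dots> \<le> b / (a + b) * tp_exp (l1 @ l2) (indicator {..1 + (A + a)})"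
        using factor IH a by (intro mult_mono) auto
      also have "(indicator {..1 + (A + a)} :: real \<Rightarrow> real) = (\<lambda>x. indicator {..1 + A} (x - a))"
        by (auto simp: indicator_def)
      also have "b / (a + b) * tp_exp (l1 @ l2) \<dots> \<le> tp_exp l (indicator {..1 + A})"
        using l unfolding l12 by (intro tp_exp_remove) auto
      finally show ?thesis .
    qed
  qed
qed

lemma tp_bound:
  assumes "tp_valid l"
  shows "0.1587 \<le> tp_exp l (indicator {..1})"
proof -
  \<comment> \<open>Adding 1 keeps \<open>s\<close> positive even for the empty list; with
    \<open>A = 0\<close> the exponential is 1 whatever \<open>s\<close> is.\<close>
  have "tp_var l \<le> (sqrt (tp_var l) + 1)\<^sup>2"
    using tp_var_nonneg[OF assms] by (simp add: power2_sum)
  then show ?thesis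
    using tp_bound_aux[OF assms, of 0 "sqrt (tp_var l) + 1"] tp_var_nonneg[OF assms]
    by (simp add: add_nonneg_pos)
qed

section \<open>Reduction to two-point variables\<close>

text \<open>Dual form of the mixture of two-point laws: by hypothesis, every slope between
  \<open>(0, c)\<close> and the graph on the left is at most every such slope on the right, so a
  line through \<open>(0, c)\<close> fits below the graph. Its slope is the supremum of the left
  slopes.\<close>

lemma supporting_line:
  fixes g :: "real \<Rightarrow> real"
  assumes g0: "c \<le> g 0"
    and g: "\<And>a b. 0 < a \<Longrightarrow> a \<le> 1 \<Longrightarrow> 0 < b \<Longrightarrow> c \<le> (b * g (- a) + a * g b) / (a + b)"
  obtains \<mu> where "\<And>x. - 1 \<le> x \<Longrightarrow> c + \<mu> * x \<le> g x"
proof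
  define f where "f a = (c - g (- a)) / a" for a
  define \<mu> where "\<mu> = (SUP a \<in> {0<..1}. f a)"
  have f: "f a \<le> (g b - c) / b" if "0 < a" "a \<le> 1" "0 < b" for a b
    using g[OF that] that by (simp add: f_def field_simps)
  show "c + \<mu> * x \<le> g x" if "- 1 \<le> x" for x
  proof (cases x "0 :: real" rule: linorder_cases)
    case less
    have "f (- x) \<le> \<mu>"
      unfolding \<mu>_def using less that f[of _ 1] by (intro cSUP_upper bdd_aboveI2) auto
    then show ?thesis using less by (simp add: f_def field_simps)
  next
    case greater
    then have "\<mu> \<le> (g x - c) / x"
      unfolding \<mu>_def using f by (intro cSUP_least) auto
    then show ?thesis using greater by (simp add: field_simps)
  qed (use g0 in simp)
qed

lemma tp_exp_measurable:
  assumes "h \<in> borel_measurable borel"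
  shows "(\<lambda>z. tp_exp l (\<lambda>y. h (z + y))) \<in> borel_measurable borel"
  using assms
proof (induction l arbitrary: h)
  case (Cons p l)
  have "(\<lambda>z. tp_exp l (\<lambda>y. h (z + y - fst p))) \<in> borel_measurable borel"
    "(\<lambda>z. tp_exp l (\<lambda>y. h (z + y + snd p))) \<in> borel_measurable borel"
    using Cons.prems
    by (intro Cons.IH[of "\<lambda>x. h (x - fst p)"] Cons.IH[of "\<lambda>x. h (x + snd p)"]; measurable)+
  then show ?case
    by (simp add: add_diff_eq flip: add.assoc)
qed simp

text \<open>The variables are replaced one at a time, and \<open>l\<close> lists the two-point
  variables already present. Freezing \<open>X i\<close> at \<open>x\<close> gives
  \<open>g x\<close>; the induction hypothesis for \<open>(a, b) # l\<close> bounds its two-point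
  means, and a supporting line of \<open>g\<close> is integrated against the centred
  \<open>X i\<close>.\<close>

lemma (in prob_space) indep_sum_tp_bound:
  fixes X :: "'i \<Rightarrow> 'a \<Rightarrow> real"
  assumes "finite I" "indep_vars (\<lambda>_. borel) X I"
    and "\<And>i. i \<in> I \<Longrightarrow> integrable M (X i)" "\<And>i. i \<in> I \<Longrightarrow> expectation (X i) = 0"
    and "\<And>i. i \<in> I \<Longrightarrow> AE \<omega> in M. - 1 \<le> X i \<omega>" "tp_valid l"
  shows "0.1587 \<le> expectation (\<lambda>\<omega>. tp_exp l (\<lambda>y. indicator {..1} ((\<Sum>i\<in>I. X i \<omega>) + y)))"
  using assms
proof (induction I arbitrary: l rule: finite_induct)
  case empty
  then show ?case
    using tp_bound[of l] by (simp add: prob_space)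
next
  case (insert i I)
  define S where "S \<omega> = (\<Sum>i\<in>I. X i \<omega>)" for \<omega>
  define H where "H l z = tp_exp l (\<lambda>y. indicator {..1 :: real} (z + y))" for l z
  have "indep_vars (\<lambda>_. borel) X I"
    using insert.prems(1) by (rule indep_vars_subset) auto
  then have IH: "0.1587 \<le> expectation (\<lambda>\<omega>. H l (S \<omega>))" if "tp_valid l" for l
    unfolding H_def S_def using insert.prems that by (intro insert.IH) auto
  have indep: "indep_var borel (X i) borel S"
    unfolding S_def using insert by (intro indep_vars_sum) auto
  have [measurable]: "X i \<in> borel_measurable M" "S \<in> borel_measurable M"
    using indep by (auto dest: indep_var_rv1 indep_var_rv2)
  have H_meas [measurable]: "H l \<in> borel_measurable borel" for l
    unfolding H_def by (intro tp_exp_measurable) simp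
  have H_bound: "norm (H l z) \<le> 1" if "tp_valid l" for l z
    using tp_exp_mono[OF that, of "\<lambda>_. 0" "\<lambda>y. indicator {..1} (z + y)"]
      tp_exp_mono[OF that, of "\<lambda>y. indicator {..1} (z + y)" "\<lambda>_. 1"]
    by (simp add: H_def tp_exp_const[OF that])
  have H_int: "integrable M (\<lambda>\<omega>. H l (S \<omega> + x))" if "tp_valid l" for l x
    using H_bound[OF that] by (intro integrable_const_bound[of _ 1]) auto
  define g where "g x = expectation (\<lambda>\<omega>. H l (S \<omega> + x))" for x
  have two_point: "0.1587 \<le> (b * g (- a) + a * g b) / (a + b)" if "0 < a" "a \<le> 1" "0 < b" for a b
  proof -
    have "0.1587 \<le> expectation (\<lambda>\<omega>. H ((a, b) # l) (S \<omega>))"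
      using that insert.prems by (intro IH) auto
    also have "\<dots> = expectation (\<lambda>\<omega>. (b * H l (S \<omega> - a) + a * H l (S \<omega> + b)) / (a + b))"
      by (simp add: H_def algebra_simps)
    also have "\<dots> = (b * g (- a) + a * g b) / (a + b)"
      using H_int[of l "- a"] H_int[of l b] insert.prems by (simp add: g_def)
    finally show ?thesis .
  qed
  have "0.1587 \<le> g 0" using IH[of l] insert.prems by (simp add: g_def)
  then obtain \<mu> where \<mu>: "0.1587 + \<mu> * x \<le> g x" if "- 1 \<le> x" for x
    using supporting_line[OF _ two_point] by blast
  interpret D1: prob_space "distr M borel (X i)" by (rule prob_space_distr) simp
  interpret D2: prob_space "distr M borel S" by (rule prob_space_distr) simp
  interpret D: pair_prob_space "distr M borel (X i)" "distr M borel S" ..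
  have g_eq: "g x = (\<integral>s. H l (s + x) \<partial>distr M borel S)" for x
    unfolding g_def by (subst integral_distr) auto
  have int_pair: "integrable (distr M borel (X i) \<Otimes>\<^sub>M distr M borel S) (\<lambda>(x, s). H l (s + x))"
    using H_bound[of l] insert.prems by (intro D.integrable_const_bound[of _ 1]) auto
  have g_int: "integrable (distr M borel (X i)) g"
    using D.integrable_fst[OF int_pair] by (simp add: g_eq[abs_def])
  have "0.1587 = expectation (\<lambda>\<omega>. 0.1587 + \<mu> * X i \<omega>)"
    using insert.prems by (simp add: prob_space)
  also have "\<dots> \<le> expectation (\<lambda>\<omega>. g (X i \<omega>))"
  proof (rule integral_mono_AE)
    show "integrable M (\<lambda>\<omega>. g (X i \<omega>))"
      using g_int by (rule integrable_distr[rotated]) simp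
    have "AE \<omega> in M. - 1 \<le> X i \<omega>" using insert.prems by auto
    then show "AE \<omega> in M. 0.1587 + \<mu> * X i \<omega> \<le> g (X i \<omega>)"
      by eventually_elim (rule \<mu>)
  qed (use insert.prems in simp)
  \<comment> \<open>The freezing is undone by Fubini on the product of the two laws, which by
    independence is the joint law of \<open>X i\<close> and \<open>S\<close>.\<close>
  also have "\<dots> = (\<integral>x. g x \<partial>distr M borel (X i))"
    using borel_measurable_integrable[OF g_int] by (subst integral_distr) auto
  also have "\<dots> = (\<integral>p. H l (snd p + fst p) \<partial>(distr M borel (X i) \<Otimes>\<^sub>M distr M borel S))"
    using D.integral_fst[OF int_pair] by (simp add: g_eq[abs_def] case_prod_beta')
  also have "\<dots> = (\<integral>p. H l (snd p + fst p) \<partial>distr M (borel \<Otimes>\<^sub>M borel) (\<lambda>\<omega>. (X i \<omega>, S \<omega>)))"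
    using indep by (simp add: indep_var_distribution_eq)
  also have "\<dots> = expectation (\<lambda>\<omega>. H l (S \<omega> + X i \<omega>))"
    by (subst integral_distr) auto
  also have "\<dots> = expectation (\<lambda>\<omega>. H l (\<Sum>i\<in>insert i I. X i \<omega>))"
    using insert.hyps by (simp add: S_def add.commute)
  finally show ?case by (simp add: H_def)
qed

theorem theorem4p3:
  fixes M :: "'a measure" and X :: "nat \<Rightarrow> 'a \<Rightarrow> real" and n :: nat
  assumes "prob_space M"
    and "n \<ge> 1"
    and "prob_space.indep_vars M (\<lambda>_. borel) X {1..n}"
    and "\<And>i. i \<in> {1..n} \<Longrightarrow> integrable M (X i)"
    and "\<And>i. i \<in> {1..n} \<Longrightarrow> (\<integral>\<omega>. X i \<omega> \<partial>M) = 0"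
    and "\<And>i. i \<in> {1..n} \<Longrightarrow> AE \<omega> in M. X i \<omega> \<ge> -1"
  shows "measure M {\<omega> \<in> space M. (\<Sum>i=1..n. X i \<omega>) \<le> 1} \<ge> 0.1587"
proof -
  interpret prob_space M by fact
  have [measurable]: "(\<lambda>\<omega>. \<Sum>i=1..n. X i \<omega>) \<in> borel_measurable M"
    using assms(4) by (intro borel_measurable_sum) (auto dest: borel_measurable_integrable)
  have "0.1587 \<le> expectation (\<lambda>\<omega>. tp_exp [] (\<lambda>y. indicator {..1} ((\<Sum>i=1..n. X i \<omega>) + y)))"
    using assms(3-6) by (intro indep_sum_tp_bound) auto
  also have "\<dots> = expectation (indicator {\<omega> \<in> space M. (\<Sum>i=1..n. X i \<omega>) \<le> 1})"
    by (intro Bochner_Integration.integral_cong) (auto simp: indicator_def)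
  also have "\<dots> = measure M {\<omega> \<in> space M. (\<Sum>i=1..n. X i \<omega>) \<le> 1}"
    by (auto intro!: arg_cong[where f = prob])
  finally show ?thesis .
qed

end
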